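(* Let $X$ be a set and $S$ a full submonoid of $I_X$. Then the following are equivalent: (i) $S$ is closed in the topology $\mathcal{I}_1$; (ii) $S$ is closed in the topology $\mathcal{I}_4$; (iii) there exists a relational structure $\mathcal{R} = (X, \mathbf{R})$ such that $S = \operatorname{ipEnd}(\mathcal{R})$.
   Context: For a set $X$, $I_X$ is the symmetric inverse monoid: the set of all bijections between subsets of $X$ (partial bijections, called charts) under composition of partial functions, written left to right (the image of $x$ under $f$ is $xf$). $E_X$ is the set of all idempotents of $I_X$, i.e. all partial identities (identity maps on subsets of $X$). A submonoid $S$ of $I_X$ is full if $E_X \subseteq S$. $\mathcal{I}_1$ is the topology on $I_X$ generated (as a subbasis) by the sets $\{ f \in I_X \mid (x,y) \in f \}$ and $\{ f \in I_X \mid (x,y) \notin f \}$ for $x,y \in X$. $\mathcal{I}_4$ is the topology on $I_X$ generated (as a subbasis) by the sets $\{ f \in I_X \mid (x,y) \in f \}$, $\{ f \in I_X \mid x \notin \operatorname{dom}(f) \}$ and $\{ f \in I_X \mid x \notin \operatorname{im}(f) \}$ for $x,y \in X$. A relational structure $\mathcal{R} = (X,\mathbf{R})$ on $X$ consists of $X$ together with an arbitrary set $\mathbf{R}$ of relations on $X$, each $R \in \mathbf{R}$ being a subset of $X^{n}$ for some natural number $n = \operatorname{dim}(R)$, its arity. For a tuple $\alpha = (a_0,\dots,a_{n-1}) \in \operatorname{dom}(f)^n$, $\alpha f = (a_0 f, \dots, a_{n-1} f)$. The set of injective partial endomorphisms of $\mathcal{R}$ is $\operatorname{ipEnd}(\mathcal{R})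 = \{ f \in I_X \mid (\forall R \in \mathbf{R})(\forall \alpha \in \operatorname{dom}(f)^{\operatorname{dim}(R)})\ \alpha \in R \Rightarrow \alpha f \in R \}$. *)

theory Defs
  imports
    "HOL-Analysis.Function_Topology"
    "HOL-Algebra.Group"
    "HOL-Library.NList"
begin

text \<open>
  Charts are represented by their graphs, so that the left-to-right composition
  of charts is relational composition \<open>O\<close>.
\<close>

definition charts :: "'a set \<Rightarrow> ('a \<times> 'a) set set" where
  "charts X = {f. f \<subseteq> X \<times> X \<and> single_valued f \<and> single_valued (f\<inverse>)}"

definition sym_inv_monoid :: "'a set \<Rightarrow> ('a \<times> 'a) set monoid" where
  "sym_inv_monoid X = \<lparr>carrier = charts X, mult = (O), one = Id_on X\<rparr>"

definition idempotents :: "'a set \<Rightarrow> ('a \<times> 'a) set set" where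
  "idempotents X = {f \<in> carrier (sym_inv_monoid X). f \<otimes>\<^bsub>sym_inv_monoid X\<^esub> f = f}"

definition full_submonoid :: "('a \<times> 'a) set set \<Rightarrow> 'a set \<Rightarrow> bool" where
  "full_submonoid S X \<longleftrightarrow> submonoid S (sym_inv_monoid X) \<and> idempotents X \<subseteq> S"

text \<open>
  \<open>topology_generated_by\<close> takes the union of the given sets as the underlying space.
  The whole space \<open>charts X\<close> (the empty intersection of subbasic sets) is therefore
  added to each subbasis; this only makes a difference when \<open>X = {}\<close>, where the
  subbases are empty but \<open>charts X = {{}}\<close>.
\<close>

definition topI1 :: "'a set \<Rightarrow> ('a \<times> 'a) set topology" where
  "topI1 X = topology_generated_by
     (insert (charts X)
       ({{f \<in> charts X. (x, y) \<in> f} | x y. x \<in> X \<and> y \<in> X} \<union>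
        {{f \<in> charts X. (x, y) \<notin> f} | x y. x \<in> X \<and> y \<in> X}))"

definition topI4 :: "'a set \<Rightarrow> ('a \<times> 'a) set topology" where
  "topI4 X = topology_generated_by
     (insert (charts X)
       ({{f \<in> charts X. (x, y) \<in> f} | x y. x \<in> X \<and> y \<in> X} \<union>
        {{f \<in> charts X. x \<notin> Domain f} | x. x \<in> X} \<union>
        {{f \<in> charts X. x \<notin> Range f} | x. x \<in> X}))"

text \<open>
  A relation on \<open>X\<close> is a pair of its arity \<open>n\<close> and a set of lists of length \<open>n\<close> over \<open>X\<close>;
  recording the arity keeps apart the empty relations of different arities.
\<close>

definition relational_structure :: "'a set \<Rightarrow> (nat \<times> 'a list set) set \<Rightarrow> bool" where
  "relational_structure X Rs \<longleftrightarrow> (\<forall>(n, R) \<in> Rs. R \<subseteq> nlists n X)"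

text \<open>The image of \<open>x\<close> under the chart \<open>f\<close>, meaningful only for \<open>x \<in> Domain f\<close>.\<close>

definition chart_app :: "('a \<times> 'a) set \<Rightarrow> 'a \<Rightarrow> 'a" where
  "chart_app f x = (THE y. (x, y) \<in> f)"

definition ipEnd :: "'a set \<Rightarrow> (nat \<times> 'a list set) set \<Rightarrow> ('a \<times> 'a) set set" where
  "ipEnd X Rs = {f \<in> charts X.
     \<forall>(n, R) \<in> Rs. \<forall>\<alpha> \<in> nlists n (Domain f). \<alpha> \<in> R \<longrightarrow> map (chart_app f) \<alpha> \<in> R}"

lemma monoid_sym_inv_monoid: "monoid (sym_inv_monoid X)"
proof (rule monoidI)
  fix f g assume "f \<in> carrier (sym_inv_monoid X)" "g \<in> carrier (sym_inv_monoid X)"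
  then show "f \<otimes>\<^bsub>sym_inv_monoid X\<^esub> g \<in> carrier (sym_inv_monoid X)"
    by (auto simp: sym_inv_monoid_def charts_def converse_relcomp single_valued_relcomp)
qed (auto simp: sym_inv_monoid_def charts_def single_valued_def)

lemma idempotents_eq: "idempotents X = {Id_on Y | Y. Y \<subseteq> X}"
proof (intro equalityI subsetI)
  fix f assume "f \<in> idempotents X"
  then have f: "f \<subseteq> X \<times> X" "single_valued f" "single_valued (f\<inverse>)" "f O f = f"
    by (auto simp: idempotents_def sym_inv_monoid_def charts_def)
  have "x = y" if "(x, y) \<in> f" for x y
  proof -
    from that f(4) obtain z where "(x, z) \<in> f" "(z, y) \<in> f" by blast
    with that f(2,3) show ?thesis unfolding single_valued_def by blast
  qed
  then have "f = Id_on (Domain f)" by fastforce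
  moreover have "Domain f \<subseteq> X" using f(1) by auto
  ultimately show "f \<in> {Id_on Y | Y. Y \<subseteq> X}" by blast
qed (auto simp: idempotents_def sym_inv_monoid_def charts_def single_valued_def)

lemma topspace_topI1: "topspace (topI1 X) = charts X"
  unfolding topI1_def topology_generated_by_topspace by auto

lemma topspace_topI4: "topspace (topI4 X) = charts X"
  unfolding topI4_def topology_generated_by_topspace by auto

lemma chart_app_eq: "f \<in> charts X \<Longrightarrow> (x, y) \<in> f \<Longrightarrow> chart_app f x = y"
  by (auto simp: charts_def single_valued_def chart_app_def)

end

theory Submission
  imports Defs
begin

text \<open>
  A full submonoid \<open>S\<close> is closed under restriction of charts. In both topologies, a chart \<open>f\<close> is
  a limit of its finite restrictions, and the charts extending a given finite chart form an open
  set. Hence for either topology \<open>S\<close> is closed iff it contains every chart all of whose finite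
  restrictions lie in \<open>S\<close>. The latter is also equivalent to being defined by relations: as
  relations one takes the orbits \<open>{\<alpha>f | f \<in> S, \<alpha> \<in> dom(f)\<^sup>n}\<close> of all tuples \<open>\<alpha>\<close>.
\<close>

definition finitely_determined :: "'a set \<Rightarrow> ('a \<times> 'a) set set \<Rightarrow> bool" where
  "finitely_determined X S \<longleftrightarrow>
     (\<forall>f \<in> charts X. (\<forall>F. finite F \<longrightarrow> F \<subseteq> f \<longrightarrow> F \<in> S) \<longrightarrow> f \<in> S)"

section \<open>Charts, restrictions and full submonoids\<close>

lemma charts_subset: "f \<in> charts X \<Longrightarrow> g \<subseteq> f \<Longrightarrow> g \<in> charts X"
  unfolding charts_def by (blast intro: single_valued_subset)

lemma chart_app_in: "f \<in> charts X \<Longrightarrow> x \<in> Domain f \<Longrightarrow> (x, chart_app f x) \<in> f"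
  using chart_app_eq by fastforce

text \<open>Left composition with the partial identity keeps exactly the pairs of \<open>f\<close>
  that start in \<open>Domain F\<close>; as \<open>f\<close> is single-valued, these are the pairs
  of \<open>F\<close>.\<close>

lemma chart_restrict_eq:
  assumes "f \<in> charts X" "F \<subseteq> f"
  shows "Id_on (Domain F) O f = F"
  using assms unfolding charts_def single_valued_def by auto blast

lemma full_submonoid_subset_charts: "full_submonoid S X \<Longrightarrow> S \<subseteq> charts X"
  using submonoid.subset[of S "sym_inv_monoid X"]
  by (simp add: full_submonoid_def) (simp add: sym_inv_monoid_def)

lemma full_submonoid_relcomp: "full_submonoid S X \<Longrightarrow> f \<in> S \<Longrightarrow> g \<in> S \<Longrightarrow> f O g \<in> S"
  using submonoid.m_closed[of S "sym_inv_monoid X" f g]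
  by (simp add: full_submonoid_def) (simp add: sym_inv_monoid_def)

lemma full_submonoid_Id_on: "full_submonoid S X \<Longrightarrow> Y \<subseteq> X \<Longrightarrow> Id_on Y \<in> S"
  unfolding full_submonoid_def idempotents_eq by auto

text \<open>Fullness supplies the partial identity on \<open>Domain F\<close>, and composing with it
  cuts \<open>f\<close> down to \<open>F\<close>.\<close>

lemma full_submonoid_restrict:
  assumes S: "full_submonoid S X" and "f \<in> S" "F \<subseteq> f"
  shows "F \<in> S"
proof -
  have f: "f \<in> charts X"
    using assms full_submonoid_subset_charts by blast
  then have "Domain F \<subseteq> X"
    using \<open>F \<subseteq> f\<close> unfolding charts_def by auto
  then have "Id_on (Domain F) O f \<in> S"
    using S \<open>f \<in> S\<close> full_submonoid_Id_on full_submonoid_relcomp by blast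
  then show ?thesis
    using chart_restrict_eq[OF f \<open>F \<subseteq> f\<close>] by simp
qed

section \<open>Finite approximation and closed sets\<close>

text \<open>The property passes from the subbasis to all open sets because unions inherit a witness
  from one member and intersections take the union of two witnesses. The latter works since the
  conclusion covers every \<open>g\<close> between \<open>F\<close> and \<open>f\<close>, not only
  \<open>F\<close> itself.\<close>

lemma generate_topology_on_finite_approx:
  assumes "generate_topology_on \<B> U"
    and "\<And>B f. B \<in> \<B> \<Longrightarrow> f \<in> B \<Longrightarrow> \<exists>F. finite F \<and> F \<subseteq> f \<and> (\<forall>g. F \<subseteq> g \<longrightarrow> g \<subseteq> f \<longrightarrow> g \<in> B)"
    and "f \<in> U"
  shows "\<exists>F. finite F \<and> F \<subseteq> f \<and> (\<forall>g. F \<subseteq> g \<longrightarrow> g \<subseteq> f \<longrightarrow> g \<in> U)"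
  using assms(1,3)
proof (induction rule: generate_topology_on.induct)
  case (Int U V)
  then obtain F G where
    "finite F" "F \<subseteq> f" "\<forall>g. F \<subseteq> g \<longrightarrow> g \<subseteq> f \<longrightarrow> g \<in> U"
    "finite G" "G \<subseteq> f" "\<forall>g. G \<subseteq> g \<longrightarrow> g \<subseteq> f \<longrightarrow> g \<in> V"
    by auto
  then show ?case
    by (intro exI[of _ "F \<union> G"]) auto
next
  case (UN K)
  then obtain U where "U \<in> K" "f \<in> U" by blast
  then obtain F where "finite F" "F \<subseteq> f" "\<forall>g. F \<subseteq> g \<longrightarrow> g \<subseteq> f \<longrightarrow> g \<in> U"
    using UN.IH by metis
  with \<open>U \<in> K\<close> show ?case by (intro exI[of _ F]) auto
qed (simp, metis assms(2))

text \<open>If a subbasic set demands a pair, that one pair is the witness. Absence of a pair is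
  inherited by every restriction, so there \<open>F = {}\<close> suffices.\<close>

lemma topI1_finite_approx:
  assumes "openin (topI1 X) U" "f \<in> U"
  shows "\<exists>F. finite F \<and> F \<subseteq> f \<and> (\<forall>g. F \<subseteq> g \<longrightarrow> g \<subseteq> f \<longrightarrow> g \<in> U)"
proof (rule generate_topology_on_finite_approx[OF _ _ assms(2)])
  show "generate_topology_on (insert (charts X)
       ({{f \<in> charts X. (x, y) \<in> f} | x y. x \<in> X \<and> y \<in> X} \<union>
        {{f \<in> charts X. (x, y) \<notin> f} | x y. x \<in> X \<and> y \<in> X})) U"
    using assms(1) unfolding topI1_def openin_topology_generated_by_iff .
next
  fix B f
  assume "B \<in> insert (charts X)
       ({{f \<in> charts X. (x, y) \<in> f} | x y. x \<in> X \<and> y \<in> X} \<union>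
        {{f \<in> charts X. (x, y) \<notin> f} | x y. x \<in> X \<and> y \<in> X})" and f: "f \<in> B"
  then consider "B = charts X" | x y where "B = {f \<in> charts X. (x, y) \<in> f}"
    | x y where "B = {f \<in> charts X. (x, y) \<notin> f}"
    by auto
  moreover have sub: "g \<in> charts X" if "g \<subseteq> f" for g
    using calculation f that by (auto intro: charts_subset[of f])
  ultimately show "\<exists>F. finite F \<and> F \<subseteq> f \<and> (\<forall>g. F \<subseteq> g \<longrightarrow> g \<subseteq> f \<longrightarrow> g \<in> B)"
  proof cases
    case (2 x y)
    with f sub show ?thesis by (intro exI[of _ "{(x, y)}"]) simp
  qed (rule exI[of _ "{}"], use f sub in fastforce)+
qed

text \<open>Avoiding \<open>x\<close> in the domain or in the range also survives restriction, so
  \<open>F = {}\<close> again serves for every subbasic set that does not demand a pair.\<close>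

lemma topI4_finite_approx:
  assumes "openin (topI4 X) U" "f \<in> U"
  shows "\<exists>F. finite F \<and> F \<subseteq> f \<and> (\<forall>g. F \<subseteq> g \<longrightarrow> g \<subseteq> f \<longrightarrow> g \<in> U)"
proof (rule generate_topology_on_finite_approx[OF _ _ assms(2)])
  show "generate_topology_on (insert (charts X)
       ({{f \<in> charts X. (x, y) \<in> f} | x y. x \<in> X \<and> y \<in> X} \<union>
        {{f \<in> charts X. x \<notin> Domain f} | x. x \<in> X} \<union>
        {{f \<in> charts X. x \<notin> Range f} | x. x \<in> X})) U"
    using assms(1) unfolding topI4_def openin_topology_generated_by_iff .
next
  fix B f
  assume "B \<in> insert (charts X)
       ({{f \<in> charts X. (x, y) \<in> f} | x y. x \<in> X \<and> y \<in> X} \<union>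
        {{f \<in> charts X. x \<notin> Domain f} | x. x \<in> X} \<union>
        {{f \<in> charts X. x \<notin> Range f} | x. x \<in> X})" and f: "f \<in> B"
  then consider "B = charts X" | x y where "B = {f \<in> charts X. (x, y) \<in> f}"
    | x where "B = {f \<in> charts X. x \<notin> Domain f}" | x where "B = {f \<in> charts X. x \<notin> Range f}"
    by auto
  moreover have sub: "g \<in> charts X" if "g \<subseteq> f" for g
    using calculation f that by (auto intro: charts_subset[of f])
  ultimately show "\<exists>F. finite F \<and> F \<subseteq> f \<and> (\<forall>g. F \<subseteq> g \<longrightarrow> g \<subseteq> f \<longrightarrow> g \<in> B)"
  proof cases
    case (2 x y)
    with f sub show ?thesis by (intro exI[of _ "{(x, y)}"]) simp
  qed (rule exI[of _ "{}"], use f sub in fastforce)+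
qed

text \<open>This is a finite intersection of the sets given by single pairs; the hypothesis on
  \<open>topspace T\<close> covers the empty intersection.\<close>

lemma openin_charts_supset:
  assumes "topspace T = charts X"
    and pair: "\<And>x y. x \<in> X \<Longrightarrow> y \<in> X \<Longrightarrow> openin T {f \<in> charts X. (x, y) \<in> f}"
    and "finite F" "F \<subseteq> X \<times> X"
  shows "openin T {f \<in> charts X. F \<subseteq> f}"
  using assms(3,4)
proof (induction rule: finite_induct)
  case empty
  then show ?case using openin_topspace[of T] assms(1) by simp
next
  case (insert p F)
  obtain x y where p: "p = (x, y)" "x \<in> X" "y \<in> X" using insert.prems by auto
  have "openin T ({f \<in> charts X. (x, y) \<in> f} \<inter> {f \<in> charts X. F \<subseteq> f})"
    using insert p pair by (intro openin_Int) auto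
  moreover have "{f \<in> charts X. insert p F \<subseteq> f}
      = {f \<in> charts X. (x, y) \<in> f} \<inter> {f \<in> charts X. F \<subseteq> f}"
    using p by auto
  ultimately show ?case by simp
qed

text \<open>An abstract \<open>T\<close> isolates what the two topologies share: pair conditions are
  open, and open sets around \<open>f\<close> contain finite restrictions of
  \<open>f\<close>.\<close>

lemma closedin_iff_finitely_determined:
  assumes top: "topspace T = charts X"
    and pair: "\<And>x y. x \<in> X \<Longrightarrow> y \<in> X \<Longrightarrow> openin T {f \<in> charts X. (x, y) \<in> f}"
    and approx: "\<And>U f. openin T U \<Longrightarrow> f \<in> U \<Longrightarrow>
      \<exists>F. finite F \<and> F \<subseteq> f \<and> (\<forall>g. F \<subseteq> g \<longrightarrow> g \<subseteq> f \<longrightarrow> g \<in> U)"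
    and "S \<subseteq> charts X"
    and restrict: "\<And>f F. f \<in> S \<Longrightarrow> F \<subseteq> f \<Longrightarrow> F \<in> S"
  shows "closedin T S \<longleftrightarrow> finitely_determined X S"
proof
  assume "closedin T S"
  then have op: "openin T (charts X - S)"
    using top by (simp add: closedin_def)
  show "finitely_determined X S"
    unfolding finitely_determined_def
  proof (intro ballI impI, rule ccontr)
    fix f assume "f \<in> charts X" "f \<notin> S" and F: "\<forall>F. finite F \<longrightarrow> F \<subseteq> f \<longrightarrow> F \<in> S"
    \<comment> \<open>Taking \<open>g = F\<close> in \<open>approx\<close> gives a finite
      restriction of \<open>f\<close> outside \<open>S\<close>.\<close>
    then obtain F where "finite F" "F \<subseteq> f" "F \<in> charts X - S"
      using approx[OF op, of f] by auto
    with F show False by auto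
  qed
next
  assume S: "finitely_determined X S"
  have "openin T (charts X - S)"
  proof (subst openin_subopen, intro ballI)
    fix f assume f: "f \<in> charts X - S"
    with S obtain F where F: "finite F" "F \<subseteq> f" "F \<notin> S"
      unfolding finitely_determined_def by blast
    have "F \<subseteq> X \<times> X"
      using f F(2) unfolding charts_def by auto
    then have "openin T {g \<in> charts X. F \<subseteq> g}"
      using openin_charts_supset[OF top pair] F(1) by blast
    \<comment> \<open>If some \<open>g\<close> in \<open>S\<close> extended \<open>F\<close>, then
      \<open>restrict\<close> would put \<open>F\<close> into \<open>S\<close>.\<close>
    moreover have "f \<in> {g \<in> charts X. F \<subseteq> g}" "{g \<in> charts X. F \<subseteq> g} \<subseteq> charts X - S"
      using f F restrict by auto
    ultimately show "\<exists>U. openin T U \<and> f \<in> U \<and> U \<subseteq> charts X - S"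
      by blast
  qed
  then show "closedin T S"
    using top \<open>S \<subseteq> charts X\<close> by (simp add: closedin_def)
qed

section \<open>Partial endomorphisms and orbit relations\<close>

lemma ipEnd_D:
  "f \<in> ipEnd X Rs \<Longrightarrow> (n, R) \<in> Rs \<Longrightarrow> \<alpha> \<in> nlists n (Domain f) \<Longrightarrow> \<alpha> \<in> R
    \<Longrightarrow> map (chart_app f) \<alpha> \<in> R"
  unfolding ipEnd_def by fast

text \<open>A tuple has finitely many entries, so whether \<open>f\<close> maps it into
  \<open>R\<close> is decided by the finite restriction of \<open>f\<close> to those
  entries.\<close>

lemma finitely_determined_ipEnd: "finitely_determined X (ipEnd X Rs)"
  unfolding finitely_determined_def
proof (intro ballI impI)
  fix f assume f: "f \<in> charts X" and fin: "\<forall>F. finite F \<longrightarrow> F \<subseteq> f \<longrightarrow> F \<in> ipEnd X Rs"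
  have "map (chart_app f) \<alpha> \<in> R" if "(n, R) \<in> Rs" "\<alpha> \<in> nlists n (Domain f)" "\<alpha> \<in> R" for n R \<alpha>
  proof -
    define F where "F = (\<lambda>x. (x, chart_app f x)) ` set \<alpha>"
    have "set \<alpha> \<subseteq> Domain f"
      using that(2) by (rule nlistsE_set)
    then have F: "finite F" "F \<subseteq> f" "Domain F = set \<alpha>"
      unfolding F_def by (simp, blast intro: chart_app_in[OF f], force)
    have "F \<in> ipEnd X Rs"
      using fin F by blast
    moreover have "\<alpha> \<in> nlists n (Domain F)"
      using nlistsE_length[OF that(2)] F(3) by (intro nlistsI) simp_all
    ultimately have "map (chart_app F) \<alpha> \<in> R"
      by (rule ipEnd_D[OF _ that(1) _ that(3)])
    moreover have "chart_app F x = chart_app f x" if "x \<in> set \<alpha>" for x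
      using that by (intro chart_app_eq[OF charts_subset[OF f F(2)]]) (auto simp: F_def)
    ultimately show ?thesis
      by (metis (no_types, lifting) map_eq_conv)
  qed
  then show "f \<in> ipEnd X Rs"
    using f unfolding ipEnd_def by blast
qed

definition orbit_relations :: "'a set \<Rightarrow> ('a \<times> 'a) set set \<Rightarrow> (nat \<times> 'a list set) set" where
  "orbit_relations X S =
     {(length \<alpha>, {map (chart_app f) \<alpha> | f. f \<in> S \<and> set \<alpha> \<subseteq> Domain f}) | \<alpha>. set \<alpha> \<subseteq> X}"

lemma relational_structure_orbit_relations:
  assumes "S \<subseteq> charts X"
  shows "relational_structure X (orbit_relations X S)"
proof -
  have "chart_app f x \<in> X" if "f \<in> S" "set \<alpha> \<subseteq> Domain f" "x \<in> set \<alpha>" for f \<alpha> x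
    using chart_app_in[of f X x] that assms unfolding charts_def by blast
  then show ?thesis
    unfolding relational_structure_def orbit_relations_def nlists_def by auto
qed

text \<open>Closure under composition is the reason: applying \<open>g\<close> to the tuple
  \<alpha>f of an orbit yields the image of \<alpha> under \<open>f O g\<close>, which lies in the
  same orbit.\<close>

lemma subset_ipEnd_orbit_relations:
  assumes S: "full_submonoid S X"
  shows "S \<subseteq> ipEnd X (orbit_relations X S)"
proof
  fix g assume g: "g \<in> S"
  have SX: "S \<subseteq> charts X"
    using S by (rule full_submonoid_subset_charts)
  have "\<exists>h. map (chart_app g) (map (chart_app f) \<alpha>) = map (chart_app h) \<alpha> \<and> h \<in> S \<and> set \<alpha> \<subseteq> Domain h"
    if f: "f \<in> S" and \<alpha>: "set \<alpha> \<subseteq> Domain f" "chart_app f ` set \<alpha> \<subseteq> Domain g" for f \<alpha>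
  proof (intro exI conjI)
    show fg: "f O g \<in> S"
      using S f g by (rule full_submonoid_relcomp)
    have *: "(x, chart_app g (chart_app f x)) \<in> f O g" if "x \<in> set \<alpha>" for x
    proof
      show "(x, chart_app f x) \<in> f"
        using that \<alpha> SX f by (blast intro: chart_app_in)
      show "(chart_app f x, chart_app g (chart_app f x)) \<in> g"
        using that \<alpha> SX g by (blast intro: chart_app_in)
    qed
    then show "set \<alpha> \<subseteq> Domain (f O g)"
      by blast
    show "map (chart_app g) (map (chart_app f) \<alpha>) = map (chart_app (f O g)) \<alpha>"
      using chart_app_eq[OF subsetD[OF SX fg] *] by simp
  qed
  then show "g \<in> ipEnd X (orbit_relations X S)"
    using g SX unfolding ipEnd_def orbit_relations_def nlists_def by auto
qed

text \<open>Preserving the orbit of a tuple forces \<open>f\<close> to agree on that tuple with some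
  member of \<open>S\<close>. Letting the tuple list the domain of a finite \<open>F\<close> inside
  \<open>f\<close> makes \<open>F\<close> a restriction of that member.\<close>

lemma ipEnd_orbit_relations_subset:
  assumes S: "full_submonoid S X" and "finitely_determined X S"
  shows "ipEnd X (orbit_relations X S) \<subseteq> S"
proof
  fix f assume f: "f \<in> ipEnd X (orbit_relations X S)"
  then have fX: "f \<in> charts X"
    by (simp add: ipEnd_def)
  have "F \<in> S" if "finite F" "F \<subseteq> f" for F
  proof -
    obtain \<alpha> where \<alpha>: "set \<alpha> = Domain F"
      using \<open>finite F\<close> finite_Domain finite_list by metis
    define R where "R = {map (chart_app g) \<alpha> | g. g \<in> S \<and> set \<alpha> \<subseteq> Domain g}"
    have \<alpha>X: "set \<alpha> \<subseteq> X" and \<alpha>f: "set \<alpha> \<subseteq> Domain f"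
      using \<alpha> \<open>F \<subseteq> f\<close> fX unfolding charts_def by auto
    \<comment> \<open>The identity places \<alpha> in its own orbit, so preservation of
      \<open>R\<close> applies to it.\<close>
    have Id: "Id_on X \<in> S"
      using S by (rule full_submonoid_Id_on) simp
    then have *: "map (chart_app (Id_on X)) \<alpha> = \<alpha>"
      using \<alpha>X full_submonoid_subset_charts[OF S] by (intro map_idI chart_app_eq[of _ X]) auto
    have "(length \<alpha>, R) \<in> orbit_relations X S"
      using \<alpha>X unfolding R_def orbit_relations_def by blast
    moreover have "\<alpha> \<in> nlists (length \<alpha>) (Domain f)"
      using \<alpha>f by (rule nlistsI[OF refl])
    moreover have "\<alpha> \<in> R"
      using Id * \<alpha>X unfolding R_def by force
    ultimately have "map (chart_app f) \<alpha> \<in> R"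
      by (rule ipEnd_D[OF f])
    then obtain g where g: "g \<in> S" "set \<alpha> \<subseteq> Domain g" "map (chart_app f) \<alpha> = map (chart_app g) \<alpha>"
      unfolding R_def by blast
    \<comment> \<open>Equality of the two mapped lists means that \<open>f\<close> and
      \<open>g\<close> agree on each entry of \<alpha>, hence on \<open>Domain F\<close>.\<close>
    have "F \<subseteq> g"
    proof (rule subrelI)
      fix x y assume xy: "(x, y) \<in> F"
      then have "x \<in> set \<alpha>" using \<alpha> by auto
      moreover have "chart_app f x = y"
        using xy \<open>F \<subseteq> f\<close> fX by (auto intro: chart_app_eq)
      ultimately show "(x, y) \<in> g"
        using g full_submonoid_subset_charts[OF S] chart_app_in[of g X x] by auto
    qed
    then show "F \<in> S"
      using full_submonoid_restrict[OF S g(1)] by blast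
  qed
  then show "f \<in> S"
    using assms(2) fX unfolding finitely_determined_def by blast
qed

lemma finitely_determined_iff_ipEnd:
  assumes "full_submonoid S X"
  shows "finitely_determined X S \<longleftrightarrow> (\<exists>Rs. relational_structure X Rs \<and> S = ipEnd X Rs)"
proof
  assume "finitely_determined X S"
  then have "S = ipEnd X (orbit_relations X S)"
    using assms subset_ipEnd_orbit_relations ipEnd_orbit_relations_subset by blast
  then show "\<exists>Rs. relational_structure X Rs \<and> S = ipEnd X Rs"
    using relational_structure_orbit_relations full_submonoid_subset_charts[OF assms] by blast
qed (auto simp: finitely_determined_ipEnd)

theorem theorem4p6:
  fixes X :: "'a set" and S :: "('a \<times> 'a) set set"
  assumes "full_submonoid S X"
  shows "(closedin (topI1 X) S \<longleftrightarrow> closedin (topI4 X) S) \<and>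
    (closedin (topI4 X) S \<longleftrightarrow>
      (\<exists>Rs :: (nat \<times> 'a list set) set. relational_structure X Rs \<and> S = ipEnd X Rs))"
proof -
  have "openin (topI1 X) {f \<in> charts X. (x, y) \<in> f}" if "x \<in> X" "y \<in> X" for x y
    unfolding topI1_def
    by (intro topology_generated_by_Basis insertI2 UnI1 CollectI exI[of _ x] exI[of _ y] conjI refl that)
  \<comment> \<open>\<open>finitely_determined X S\<close> is the common link: closedness in each
    topology and definability by relations are all compared with it.\<close>
  then have "closedin (topI1 X) S \<longleftrightarrow> finitely_determined X S"
    by (rule closedin_iff_finitely_determined[OF topspace_topI1 _ topI1_finite_approx
          full_submonoid_subset_charts[OF assms] full_submonoid_restrict[OF assms]])
  moreover have "openin (topI4 X) {f \<in> charts X. (x, y) \<in> f}" if "x \<in> X" "y \<in> X" for x y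
    unfolding topI4_def
    by (intro topology_generated_by_Basis insertI2 UnI1 CollectI exI[of _ x] exI[of _ y] conjI refl that)
  then have "closedin (topI4 X) S \<longleftrightarrow> finitely_determined X S"
    by (rule closedin_iff_finitely_determined[OF topspace_topI4 _ topI4_finite_approx
          full_submonoid_subset_charts[OF assms] full_submonoid_restrict[OF assms]])
  ultimately show ?thesis
    using finitely_determined_iff_ipEnd[OF assms] by blast
qed

end
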